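(* Let $A$ be a finite non-empty set of agents and $\mathsf{Prop}$ a countable set of propositional variables. For every formula $\varphi$ of the language $\mathcal{L}_{KS}$: if $\vdash_{\mathsf{SSL}}\varphi$, then $\varphi$ is valid on the class of all simplicial secrecy models, i.e. $M,X\Vdash\varphi$ for every simplicial secrecy model $M$ and every facet $X$ of $M$.
   Context: A simplicial complex is a pair $(V,\mathcal{F})$ with $V$ a non-empty set and $\mathcal{F}$ a non-empty family of finite non-empty subsets of $V$ (faces), closed under non-empty subsets. A facet is an inclusion-maximal face; $\mathrm{Fac}$ denotes the set of facets. An $A$-chromatic simplicial complex is $(V,\mathcal{F},\chi)$ with $\chi:V\to A$ injective on every face. An $A$-chromatic simplicial epistemic model is $(V,\mathcal{F},\chi,\nu)$ where $(V,\mathcal{F},\chi)$ is $A$-chromatic, every facet $X$ satisfies $\chi[X]=A$, every vertex lies in some facet, and $\nu:\mathrm{Fac}\to\mathcal{P}(\mathsf{Prop})$. For a facet $X$ and $a\in A$, $v_a(X)$ is the unique vertex of colour $a$ in $X$; for a vertex $v$, $\mathrm{St}(v)=\{X\in\mathrm{Fac}: v\in X\}$; $X\sim_a Y$ iff $v_a(X)=v_a(Y)$. A simplicial secrecy model is $M=(V,\mathcal{F},\chi,\nu,\{N^S_a\}_{a\in A})$ where $(V,\mathcal{F},\chi,\nu)$ is such a model and, with $V_a=\{v:\chi(v)=a\}$, each $N_a^S:V_a\to\mathcal{P}(\mathcal{P}(\mathrm{Fac}(M)))$ satisfies (SN): for every $a$, $v\in V_a$, $U\in N_a^S(v)$, every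 $X\in\mathrm{St}(v)$ and every $b\in A\setminus\{a\}$ there is a facet $Y$ with $X\sim_b Y$ and $Y\notin U$. The language $\mathcal{L}_{KS}$ is $\varphi::=p\mid\neg\varphi\mid(\varphi\wedge\varphi)\mid K_a\varphi\mid S_a\varphi$ ($p\in\mathsf{Prop}$, $a\in A$), with the usual abbreviations. Truth at facets: $M,X\Vdash p$ iff $p\in\nu(X)$; Boolean clauses as usual; $M,X\Vdash K_a\varphi$ iff $M,Y\Vdash\varphi$ for all facets $Y$ with $X\sim_a Y$; $M,X\Vdash S_a\varphi$ iff $M,X\Vdash K_a\varphi$ and $[\![\varphi]\!]\in N_a^S(v_a(X))$, where $[\![\varphi]\!]=\{Y\in\mathrm{Fac}(M):M,Y\Vdash\varphi\}$. The system $\mathsf{SSL}$ has axioms: all propositional tautologies; for each $a\in A$: (K) $K_a(\varphi\to\psi)\to(K_a\varphi\to K_a\psi)$, (T) $K_a\varphi\to\varphi$, (4) $K_a\varphi\to K_aK_a\varphi$, (5) $\neg K_a\varphi\to K_a\neg K_a\varphi$, (S1) $S_a\varphi\to K_a\varphi$, (S4) $S_a\varphi\to K_aS_a\varphi$; and for distinct $a,b\in A$: (S2) $S_a\varphi\to\neg K_b\varphi$. Rules: modus ponens; from $\varphi$ infer $K_a\varphi$; from $\vdash\varphi\leftrightarrow\psi$ infer $\vdash S_a\varphi\leftrightarrow S_a\psi$. *)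

theory Defs
  imports Main "HOL-Library.Countable"
begin

text \<open>The set of agents is the universe of a type \<open>'a\<close> and the set of propositional variables
  the universe of a type \<open>'p\<close>; finiteness and countability are imposed by sort constraints.
  Types are non-empty, which for \<open>'p\<close> only leaves out the case of an empty language.\<close>

datatype ('a, 'p) fm =
    Pro 'p
  | Neg "('a, 'p) fm"
  | Con "('a, 'p) fm" "('a, 'p) fm"
  | Know 'a "('a, 'p) fm"
  | Secret 'a "('a, 'p) fm"

abbreviation Imp :: "('a, 'p) fm \<Rightarrow> ('a, 'p) fm \<Rightarrow> ('a, 'p) fm" where
  "Imp \<phi> \<psi> \<equiv> Neg (Con \<phi> (Neg \<psi>))"

abbreviation Iff :: "('a, 'p) fm \<Rightarrow> ('a, 'p) fm \<Rightarrow> ('a, 'p) fm" where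
  "Iff \<phi> \<psi> \<equiv> Con (Imp \<phi> \<psi>) (Imp \<psi> \<phi>)"

text \<open>Propositional evaluation treats variables and modal formulas alike as atoms, with truth
  values given by \<open>h\<close>; so \<open>tautology\<close> covers all substitution instances of propositional
  tautologies.\<close>

primrec prop_eval :: "(('a, 'p) fm \<Rightarrow> bool) \<Rightarrow> ('a, 'p) fm \<Rightarrow> bool" where
  "prop_eval h (Pro p) \<longleftrightarrow> h (Pro p)"
| "prop_eval h (Neg \<phi>) \<longleftrightarrow> \<not> prop_eval h \<phi>"
| "prop_eval h (Con \<phi> \<psi>) \<longleftrightarrow> prop_eval h \<phi> \<and> prop_eval h \<psi>"
| "prop_eval h (Know a \<phi>) \<longleftrightarrow> h (Know a \<phi>)"
| "prop_eval h (Secret a \<phi>) \<longleftrightarrow> h (Secret a \<phi>)"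

definition tautology :: "('a, 'p) fm \<Rightarrow> bool" where
  "tautology \<phi> \<longleftrightarrow> (\<forall>h. prop_eval h \<phi>)"

inductive SSL :: "('a, 'p) fm \<Rightarrow> bool" (\<open>\<turnstile>\<^sub>S\<^sub>S\<^sub>L _\<close> [50] 50) where
  Taut: "tautology \<phi> \<Longrightarrow> \<turnstile>\<^sub>S\<^sub>S\<^sub>L \<phi>"
| AxK: "\<turnstile>\<^sub>S\<^sub>S\<^sub>L Imp (Know a (Imp \<phi> \<psi>)) (Imp (Know a \<phi>) (Know a \<psi>))"
| AxT: "\<turnstile>\<^sub>S\<^sub>S\<^sub>L Imp (Know a \<phi>) \<phi>"
| Ax4: "\<turnstile>\<^sub>S\<^sub>S\<^sub>L Imp (Know a \<phi>) (Know a (Know a \<phi>))"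
| Ax5: "\<turnstile>\<^sub>S\<^sub>S\<^sub>L Imp (Neg (Know a \<phi>)) (Know a (Neg (Know a \<phi>)))"
| AxS1: "\<turnstile>\<^sub>S\<^sub>S\<^sub>L Imp (Secret a \<phi>) (Know a \<phi>)"
| AxS4: "\<turnstile>\<^sub>S\<^sub>S\<^sub>L Imp (Secret a \<phi>) (Know a (Secret a \<phi>))"
| AxS2: "a \<noteq> b \<Longrightarrow> \<turnstile>\<^sub>S\<^sub>S\<^sub>L Imp (Secret a \<phi>) (Neg (Know b \<phi>))"
| MP: "\<turnstile>\<^sub>S\<^sub>S\<^sub>L \<phi> \<Longrightarrow> \<turnstile>\<^sub>S\<^sub>S\<^sub>L Imp \<phi> \<psi> \<Longrightarrow> \<turnstile>\<^sub>S\<^sub>S\<^sub>L \<psi>"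
| Nec: "\<turnstile>\<^sub>S\<^sub>S\<^sub>L \<phi> \<Longrightarrow> \<turnstile>\<^sub>S\<^sub>S\<^sub>L Know a \<phi>"
| RE: "\<turnstile>\<^sub>S\<^sub>S\<^sub>L Iff \<phi> \<psi> \<Longrightarrow> \<turnstile>\<^sub>S\<^sub>S\<^sub>L Iff (Secret a \<phi>) (Secret a \<psi>)"

record 'v cplx =
  verts :: "'v set"
  faces :: "'v set set"

record ('v, 'a) chromatic_cplx = "'v cplx" +
  colour :: "'v \<Rightarrow> 'a"

record ('v, 'a, 'p) epistemic_model = "('v, 'a) chromatic_cplx" +
  val :: "'v set \<Rightarrow> 'p set"

record ('v, 'a, 'p) secrecy_model = "('v, 'a, 'p) epistemic_model" +
  nbhd :: "'a \<Rightarrow> 'v \<Rightarrow> 'v set set set"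

definition simplicial_complex :: "('v, 'z) cplx_scheme \<Rightarrow> bool" where
  "simplicial_complex C \<longleftrightarrow>
     verts C \<noteq> {} \<and> faces C \<noteq> {} \<and>
     (\<forall>X \<in> faces C. X \<subseteq> verts C \<and> finite X \<and> X \<noteq> {}) \<and>
     (\<forall>X \<in> faces C. \<forall>Y. Y \<subseteq> X \<longrightarrow> Y \<noteq> {} \<longrightarrow> Y \<in> faces C)"

definition facets :: "('v, 'z) cplx_scheme \<Rightarrow> 'v set set" where
  "facets C = {X \<in> faces C. \<forall>Y \<in> faces C. X \<subseteq> Y \<longrightarrow> Y = X}"

definition star :: "('v, 'z) cplx_scheme \<Rightarrow> 'v \<Rightarrow> 'v set set" where
  "star C v = {X \<in> facets C. v \<in> X}"

definition chromatic_complex :: "('v, 'a, 'z) chromatic_cplx_scheme \<Rightarrow> bool" where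
  "chromatic_complex C \<longleftrightarrow>
     simplicial_complex C \<and> (\<forall>X \<in> faces C. inj_on (colour C) X)"

definition colour_class :: "('v, 'a, 'z) chromatic_cplx_scheme \<Rightarrow> 'a \<Rightarrow> 'v set" where
  "colour_class C a = {v \<in> verts C. colour C v = a}"

definition vertex_of :: "('v, 'a, 'z) chromatic_cplx_scheme \<Rightarrow> 'a \<Rightarrow> 'v set \<Rightarrow> 'v" where
  "vertex_of C a X = (THE v. v \<in> X \<and> colour C v = a)"

definition indist :: "('v, 'a, 'z) chromatic_cplx_scheme \<Rightarrow> 'a \<Rightarrow> 'v set \<Rightarrow> 'v set \<Rightarrow> bool" where
  "indist C a X Y \<longleftrightarrow> vertex_of C a X = vertex_of C a Y"

definition simplicial_epistemic_model :: "('v, 'a, 'p, 'z) epistemic_model_scheme \<Rightarrow> bool" where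
  "simplicial_epistemic_model M \<longleftrightarrow>
     chromatic_complex M \<and>
     (\<forall>X \<in> facets M. colour M ` X = UNIV) \<and>
     (\<forall>v \<in> verts M. \<exists>X \<in> facets M. v \<in> X)"

text \<open>The fields \<open>colour\<close>, \<open>val\<close> and \<open>nbhd\<close> are total functions; only their values on vertices,
  on facets and, for \<open>nbhd M a\<close>, on vertices of colour \<open>a\<close> are meaningful.\<close>

definition simplicial_secrecy_model :: "('v, 'a, 'p, 'z) secrecy_model_scheme \<Rightarrow> bool" where
  "simplicial_secrecy_model M \<longleftrightarrow>
     simplicial_epistemic_model M \<and>
     (\<forall>a. \<forall>v \<in> colour_class M a. nbhd M a v \<subseteq> Pow (facets M)) \<and>
     (\<forall>a. \<forall>v \<in> colour_class M a. \<forall>U \<in> nbhd M a v. \<forall>X \<in> star M v. \<forall>b. b \<noteq> a \<longrightarrow>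
        (\<exists>Y \<in> facets M. indist M b X Y \<and> Y \<notin> U))"

primrec sat :: "('v, 'a, 'p, 'z) secrecy_model_scheme \<Rightarrow> 'v set \<Rightarrow> ('a, 'p) fm \<Rightarrow> bool"
    (\<open>_, _ \<tturnstile> _\<close> [51, 51, 51] 50) where
  "M, X \<tturnstile> Pro p \<longleftrightarrow> p \<in> val M X"
| "M, X \<tturnstile> Neg \<phi> \<longleftrightarrow> \<not> (M, X \<tturnstile> \<phi>)"
| "M, X \<tturnstile> Con \<phi> \<psi> \<longleftrightarrow> (M, X \<tturnstile> \<phi>) \<and> (M, X \<tturnstile> \<psi>)"
| "M, X \<tturnstile> Know a \<phi> \<longleftrightarrow> (\<forall>Y \<in> facets M. indist M a X Y \<longrightarrow> (M, Y \<tturnstile> \<phi>))"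
| "M, X \<tturnstile> Secret a \<phi> \<longleftrightarrow>
     (\<forall>Y \<in> facets M. indist M a X Y \<longrightarrow> (M, Y \<tturnstile> \<phi>)) \<and>
     {Y \<in> facets M. M, Y \<tturnstile> \<phi>} \<in> nbhd M a (vertex_of M a X)"

end

(* Whether Know a \<phi> or Secret a \<phi> holds at a facet X depends on X only through the a-coloured vertex
   of X, and on \<phi> only through the set of facets where \<phi> is true.  The first fact gives the
   introspection axioms 4, 5 and S4, the second the rule for equivalents under Secret a.  The only
   axiom that needs condition (SN) is S2: SN applied to the truth set of \<phi> at the a-coloured vertex
   of X gives a facet that b cannot tell apart from X and where \<phi> fails. *)

theory Submission imports Defs begin

lemma sat_Imp: "M, X \<tturnstile> Imp \<phi> \<psi> \<longleftrightarrow> (M, X \<tturnstile> \<phi> \<longrightarrow> M, X \<tturnstile> \<psi>)"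
  by simp

lemma sat_Iff: "M, X \<tturnstile> Iff \<phi> \<psi> \<longleftrightarrow> (M, X \<tturnstile> \<phi> \<longleftrightarrow> M, X \<tturnstile> \<psi>)"
  by auto

lemma prop_eval_sat: "prop_eval (\<lambda>\<psi>. M, X \<tturnstile> \<psi>) \<phi> \<longleftrightarrow> M, X \<tturnstile> \<phi>"
  by (induction \<phi>) simp_all

lemma sat_tautology:
  assumes "tautology \<phi>"
  shows "M, X \<tturnstile> \<phi>"
proof -
  have "prop_eval (\<lambda>\<psi>. M, X \<tturnstile> \<psi>) \<phi>"
    using assms by (simp add: tautology_def)
  then show ?thesis
    by (simp only: prop_eval_sat)
qed

definition indist_invariant ::
    "('v, 'a, 'p, 'z) secrecy_model_scheme \<Rightarrow> 'a \<Rightarrow> ('a, 'p) fm \<Rightarrow> bool" where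
  "indist_invariant M a \<phi> \<longleftrightarrow> (\<forall>X Y. indist M a X Y \<longrightarrow> (M, X \<tturnstile> \<phi> \<longleftrightarrow> M, Y \<tturnstile> \<phi>))"

lemma indist_invariant_Neg: "indist_invariant M a \<phi> \<Longrightarrow> indist_invariant M a (Neg \<phi>)"
  by (simp add: indist_invariant_def)

lemma indist_invariant_Know: "indist_invariant M a (Know a \<phi>)"
  by (simp add: indist_invariant_def indist_def)

lemma indist_invariant_Secret: "indist_invariant M a (Secret a \<phi>)"
  by (simp add: indist_invariant_def indist_def)

lemma sat_Know_if_indist_invariant:
  assumes "indist_invariant M a \<phi>" and "M, X \<tturnstile> \<phi>"
  shows "M, X \<tturnstile> Know a \<phi>"
  using assms by (auto simp: indist_invariant_def)

lemma sat_if_sat_Know: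
  assumes "X \<in> facets M" and "M, X \<tturnstile> Know a \<phi>"
  shows "M, X \<tturnstile> \<phi>"
  using assms by (simp add: indist_def)

definition truth_set ::
    "('v, 'a, 'p, 'z) secrecy_model_scheme \<Rightarrow> ('a, 'p) fm \<Rightarrow> 'v set set" where
  "truth_set M \<phi> = {X \<in> facets M. M, X \<tturnstile> \<phi>}"

lemma truth_set_eq_iff:
  "truth_set M \<phi> = truth_set M \<psi> \<longleftrightarrow> (\<forall>X \<in> facets M. M, X \<tturnstile> Iff \<phi> \<psi>)"
  unfolding truth_set_def sat_Iff by blast

lemma sat_Know_iff_truth_set:
  "M, X \<tturnstile> Know a \<phi> \<longleftrightarrow> {Y \<in> facets M. indist M a X Y} \<subseteq> truth_set M \<phi>"
  by (auto simp: truth_set_def)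

lemma sat_Secret_iff_truth_set:
  "M, X \<tturnstile> Secret a \<phi> \<longleftrightarrow>
     M, X \<tturnstile> Know a \<phi> \<and> truth_set M \<phi> \<in> nbhd M a (vertex_of M a X)"
  by (simp add: truth_set_def)

lemma sat_Secret_truth_set_cong:
  assumes "truth_set M \<phi> = truth_set M \<psi>"
  shows "M, X \<tturnstile> Secret a \<phi> \<longleftrightarrow> M, X \<tturnstile> Secret a \<psi>"
  by (simp only: sat_Secret_iff_truth_set sat_Know_iff_truth_set assms)

lemma vertex_of_eq_the_inv_into: "vertex_of C a X = the_inv_into X (colour C) a"
  by (simp add: vertex_of_def the_inv_into_def)

lemma facet_inj_on_colour:
  assumes "chromatic_complex C" and "X \<in> facets C"
  shows "inj_on (colour C) X"
  using assms by (simp add: chromatic_complex_def facets_def)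

lemma facet_in_star_vertex_of:
  assumes "chromatic_complex C" and "X \<in> facets C" and "a \<in> colour C ` X"
  shows "X \<in> star C (vertex_of C a X)"
  using the_inv_into_into[OF facet_inj_on_colour[OF assms(1,2)] assms(3) subset_refl] assms(2)
  by (simp add: star_def vertex_of_eq_the_inv_into)

lemma vertex_of_in_colour_class:
  assumes "chromatic_complex C" and "X \<in> facets C" and "a \<in> colour C ` X"
  shows "vertex_of C a X \<in> colour_class C a"
proof -
  have "vertex_of C a X \<in> X"
    using facet_in_star_vertex_of[OF assms] by (simp add: star_def)
  moreover have "X \<subseteq> verts C"
    using assms(1,2) by (simp add: chromatic_complex_def simplicial_complex_def facets_def)
  moreover have "colour C (vertex_of C a X) = a"
    using f_the_inv_into_f[OF facet_inj_on_colour[OF assms(1,2)] assms(3)]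
    by (simp add: vertex_of_eq_the_inv_into)
  ultimately show ?thesis
    by (auto simp: colour_class_def)
qed

lemma secrecy_nbhd_escape:
  assumes model: "simplicial_secrecy_model M" and facet: "X \<in> facets M"
    and "U \<in> nbhd M a (vertex_of M a X)" and "b \<noteq> a"
  obtains Y where "Y \<in> facets M" and "indist M b X Y" and "Y \<notin> U"
proof -
  have "chromatic_complex M" and "a \<in> colour M ` X"
    using model facet by (simp_all add: simplicial_secrecy_model_def simplicial_epistemic_model_def)
  then have "vertex_of M a X \<in> colour_class M a" and "X \<in> star M (vertex_of M a X)"
    using facet by (simp_all add: vertex_of_in_colour_class facet_in_star_vertex_of)
  then show thesis
    using assms that unfolding simplicial_secrecy_model_def by blast
qed

lemma sat_Neg_Know_if_sat_Secret:
  assumes "simplicial_secrecy_model M" and "X \<in> facets M"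
    and "M, X \<tturnstile> Secret a \<phi>" and "b \<noteq> a"
  shows "M, X \<tturnstile> Neg (Know b \<phi>)"
proof -
  have "truth_set M \<phi> \<in> nbhd M a (vertex_of M a X)"
    using assms(3) by (simp only: sat_Secret_iff_truth_set)
  then obtain Y where "Y \<in> facets M" and "indist M b X Y" and "Y \<notin> truth_set M \<phi>"
    using assms by (blast elim: secrecy_nbhd_escape)
  then show ?thesis
    unfolding sat.simps(2) sat_Know_iff_truth_set by blast
qed

theorem SSL_sound:
  fixes M :: "('v, 'a, 'p, 'z) secrecy_model_scheme"
  assumes "\<turnstile>\<^sub>S\<^sub>S\<^sub>L \<phi>" and model: "simplicial_secrecy_model M" and "X \<in> facets M"
  shows "M, X \<tturnstile> \<phi>"
  using assms(1,3)
proof (induction arbitrary: X rule: SSL.induct)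
  case (Taut \<phi>)
  then show ?case by (simp only: sat_tautology)
next
  case (AxK a \<phi> \<psi>)
  show ?case unfolding sat_Imp sat.simps(4) by blast
next
  case (AxT a \<phi>)
  show ?case
    unfolding sat_Imp using sat_if_sat_Know[OF AxT.prems] by (rule impI)
next
  case (Ax4 a \<phi>)
  show ?case
    unfolding sat_Imp using sat_Know_if_indist_invariant[OF indist_invariant_Know] by (rule impI)
next
  case (Ax5 a \<phi>)
  have "indist_invariant M a (Neg (Know a \<phi>))"
    by (intro indist_invariant_Neg indist_invariant_Know)
  then show ?case
    unfolding sat_Imp by (intro impI) (rule sat_Know_if_indist_invariant)
next
  case (AxS1 a \<phi>)
  show ?case unfolding sat_Imp sat_Secret_iff_truth_set by blast
next
  case (AxS4 a \<phi>)
  show ?case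
    unfolding sat_Imp using sat_Know_if_indist_invariant[OF indist_invariant_Secret] by (rule impI)
next
  case (AxS2 a b \<phi>)
  then have "b \<noteq> a" by simp
  with model AxS2.prems show ?case
    unfolding sat_Imp by (blast intro: sat_Neg_Know_if_sat_Secret)
next
  case (MP \<phi> \<psi>)
  then show ?case unfolding sat_Imp by blast
next
  case (Nec \<phi> a)
  then show ?case by simp
next
  case (RE \<phi> \<psi> a)
  have "truth_set M \<phi> = truth_set M \<psi>"
    using RE.IH unfolding truth_set_eq_iff by blast
  then show ?case
    unfolding sat_Iff by (rule sat_Secret_truth_set_cong)
qed

theorem theorem5p3:
  fixes \<phi> :: "('a::finite, 'p::countable) fm"
  assumes "\<turnstile>\<^sub>S\<^sub>S\<^sub>L \<phi>"
  shows "\<forall>(M :: ('v, 'a, 'p) secrecy_model) X.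
    simplicial_secrecy_model M \<longrightarrow> X \<in> facets M \<longrightarrow> M, X \<tturnstile> \<phi>"
  using SSL_sound[OF assms] by blast

end
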